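(* For a Bézout domain $R$ the following statements are equivalent: (1) $R$ is an elementary divisor ring. (2) For all triples $(a,b,s)\in R^3$, there exists a pair $(q,r)\in R^2$ such that by defining $y:=r+s-asq-bsr$ and $t:=1+q-aq-br$ we have $t\in Ry+Rat$ (equivalently, there exists a product decomposition $y=y_1y_2$ in $R$ such that $y_1$ divides $t$ and $(a,y_2)\in Um(R^2)$). (3) For each triple $(a,b,s)\in R^3$ there exists $(e,f)\in Um(R^2)$ such that $(a,e),\,(be+af,\,1-bs-a)\in Um(R^2)$.
   Context: A Bézout domain is an integral domain in which each finitely generated ideal is principal. $Um(R^2)$ is the set of pairs generating the unit ideal of $R$. $R$ is an elementary divisor ring if for all $m,n\ge 1$ each $m\times n$ matrix over $R$ is equivalent (via multiplication by invertible matrices on the left and right) to a matrix whose off-diagonal entries are $0$ and whose diagonal entries $a_{1,1},\ldots,a_{k,k}$, $k=\min\{m,n\}$, satisfy $a_{i,i}\mid a_{i+1,i+1}$ for $1\le i\le k-1$. *)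

theory Defs
  imports "Jordan_Normal_Form.Matrix"
begin

text \<open>A commutative ring is a module over itself; its submodules are its ideals, so
  \<^term>\<open>Modules.module.span (*) S\<close> is the ideal generated by \<open>S\<close>.\<close>

lemma module_self: "Modules.module ((*) :: 'a::comm_ring_1 \<Rightarrow> 'a \<Rightarrow> 'a)"
  by unfold_locales (simp_all add: algebra_simps)

definition ideal_generated :: "'a::comm_ring_1 set \<Rightarrow> 'a set" where
  "ideal_generated S = Modules.module.span (*) S"

definition bezout_domain :: "'a::idom itself \<Rightarrow> bool" where
  "bezout_domain _ \<longleftrightarrow>
    (\<forall>S :: 'a set. finite S \<longrightarrow> (\<exists>d. ideal_generated S = ideal_generated {d}))"

definition Um2 :: "('a::comm_ring_1 \<times> 'a) set" where
  "Um2 = {(x, y). ideal_generated {x, y} = UNIV}"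

definition mat_equiv :: "'a::comm_ring_1 mat \<Rightarrow> 'a mat \<Rightarrow> bool" where
  "mat_equiv A D \<longleftrightarrow>
    (\<exists>P Q. P \<in> carrier_mat (dim_row A) (dim_row A) \<and> invertible_mat P \<and>
           Q \<in> carrier_mat (dim_col A) (dim_col A) \<and> invertible_mat Q \<and>
           D = P * A * Q)"

text \<open>Matrix indices start at \<open>0\<close>.\<close>

definition elementary_divisor_ring :: "'a::comm_ring_1 itself \<Rightarrow> bool" where
  "elementary_divisor_ring _ \<longleftrightarrow>
    (\<forall>m\<ge>1. \<forall>n\<ge>1. \<forall>A \<in> carrier_mat m n.
      \<exists>D :: 'a mat. mat_equiv A D \<and> diagonal_mat D \<and>
        (\<forall>i. i + 1 < min m n \<longrightarrow> D $$ (i, i) dvd D $$ (i + 1, i + 1)))"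

end

(*
  Both conditions (2) and (3) are compared with Kaplansky's criterion: for every unimodular triple
  (a, b, c) there are p, q with (p a, p b + q c) unimodular.  Condition (3) is this criterion for
  the triples with a + b s + c = 1, and the general case x a + y b + z c = 1 follows by applying it
  to (x a, b, z c).

  The criterion says that the matrix [[a, b], [0, c]] admits vectors u, v with u A v = 1.  Over a
  Bezout domain it extends, one row or column at a time, to an m x n matrix A: there are u, v such
  that u A v divides every entry of A.  Up to scalars, u and v complete to invertible matrices, so
  A is equivalent to a matrix whose corner entry divides all entries; clearing the first row and
  column and induction give the diagonal form.
*)

theory Submission
  imports Defs
begin

section \<open>Unimodular pairs and greatest common divisors\<close>

lemma ideal_generated_pair_iff:
  "x \<in> ideal_generated {a, b} \<longleftrightarrow> (\<exists>u v. x = u * a + v * b)" for a b x :: "'a::comm_ring_1"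
proof -
  interpret self: Modules.module "(*) :: 'a \<Rightarrow> 'a \<Rightarrow> 'a" by (rule module_self)
  show ?thesis
    by (simp add: ideal_generated_def self.span_breakdown_eq algebra_simps)
qed

lemma ideal_generated_single_iff:
  "x \<in> ideal_generated {a} \<longleftrightarrow> a dvd x" for a x :: "'a::comm_ring_1"
proof -
  have "x \<in> ideal_generated {a} \<longleftrightarrow> (\<exists>u v. x = u * a + v * a)"
    using ideal_generated_pair_iff[of x a a] by simp
  also have "\<dots> \<longleftrightarrow> a dvd x"
    by (metis add.right_neutral distrib_right dvd_def mult.commute mult_zero_left)
  finally show ?thesis .
qed

lemma Um2_iff: "(x, y) \<in> Um2 \<longleftrightarrow> (\<exists>u v. u * x + v * y = 1)" for x y :: "'a::comm_ring_1"
proof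
  assume "(x, y) \<in> Um2"
  then have "1 \<in> ideal_generated {x, y}" by (simp add: Um2_def)
  then show "\<exists>u v. u * x + v * y = 1" by (metis ideal_generated_pair_iff)
next
  assume "\<exists>u v. u * x + v * y = 1"
  then obtain u v where uv: "u * x + v * y = 1" by blast
  have "z = (z * u) * x + (z * v) * y" for z
    using uv by (metis distrib_left mult.assoc mult.right_neutral)
  then show "(x, y) \<in> Um2"
    unfolding Um2_def using ideal_generated_pair_iff by blast
qed

lemma Um2_commute: "(x, y) \<in> Um2 \<longleftrightarrow> (y, x) \<in> Um2"
  by (simp add: Um2_def insert_commute)

lemma Um2_dvd: "(x, y) \<in> Um2 \<Longrightarrow> z dvd y \<Longrightarrow> (x, z) \<in> Um2"
  by (metis Um2_iff dvd_def mult.assoc mult.commute)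

lemma Um2_mult:
  fixes x :: "'a::comm_ring_1"
  assumes "(x, y) \<in> Um2" "(x, z) \<in> Um2"
  shows "(x, y * z) \<in> Um2"
proof -
  obtain a b c d where "a * x + b * y = 1" "c * x + d * z = 1"
    using assms by (auto simp: Um2_iff)
  then have "(a * x + b * y) * (c * x + d * z) = 1" by simp
  then have "(a * c * x + a * d * z + b * y * c) * x + (b * d) * (y * z) = 1"
    by (simp add: algebra_simps)
  then show ?thesis by (auto simp: Um2_iff)
qed

lemma Um2_add_mult: "(x, y + k * x) \<in> Um2 \<longleftrightarrow> (x, y) \<in> Um2" for x :: "'a::comm_ring_1"
proof -
  have *: "(x, y + k * x) \<in> Um2" if xy: "(x, y) \<in> Um2" for y k
  proof -
    obtain u v where "u * x + v * y = 1" using xy by (auto simp: Um2_iff)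
    then have "(u - v * k) * x + v * (y + k * x) = 1" by (simp add: algebra_simps)
    then show ?thesis by (auto simp: Um2_iff)
  qed
  show ?thesis using *[of y k] *[of "y + k * x" "- k"] by auto
qed

text \<open>The ideal generated by a and y contains t by the first assumption, hence both t and y,
  which generate the unit ideal. This is applied after the gcd of y and t has been
  cancelled.\<close>

lemma Um2_if_mem:
  fixes a y t :: "'a::comm_ring_1"
  assumes t: "t = u * y + v * (a * t)" and "k * y + l * t = 1"
  shows "(a, y) \<in> Um2"
proof -
  have "(l * t * v) * a + (k + l * u) * y = k * y + l * (u * y + v * (a * t))"
    by (simp add: algebra_simps)
  also have "\<dots> = 1" using assms by simp
  finally show ?thesis by (auto simp: Um2_iff)
qed

text \<open>Cancelling d from its own Bezout identity gives one for the cofactors. Including the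
  zero pair lets later lemmas be stated for arbitrary entries.\<close>

lemma bezout_domain_gcd:
  fixes x y :: "'a::idom"
  assumes "bezout_domain TYPE('a)"
  obtains d x' y' s t where "x = d * x'" "y = d * y'" "s * x' + t * y' = 1"
proof -
  obtain d where d: "ideal_generated {x, y} = ideal_generated {d}"
    using assms unfolding bezout_domain_def by (meson finite.emptyI finite.insertI)
  have "x \<in> ideal_generated {x, y}" "y \<in> ideal_generated {x, y}"
    using ideal_generated_pair_iff[of _ x y]
    by (metis add.right_neutral mult_1 mult_zero_left, metis add_0 mult_1 mult_zero_left)
  then obtain x' y' where xy: "x = d * x'" "y = d * y'"
    unfolding d ideal_generated_single_iff by (auto elim!: dvdE)
  have "d \<in> ideal_generated {x, y}"
    unfolding d ideal_generated_single_iff by simp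
  then obtain s t where st: "d = s * x + t * y"
    by (auto simp: ideal_generated_pair_iff)
  show thesis
  proof (cases "d = 0")
    case True
    \<comment> \<open>Both elements vanish, so nothing is known about the cofactors found above;
      they are replaced by the coprime pair (1, 0).\<close>
    then show ?thesis using that[of 0 1 0 1 0] xy by simp
  next
    case False
    have "d * (s * x' + t * y') = d * 1"
      using st unfolding xy by (simp add: algebra_simps)
    then have "s * x' + t * y' = 1" using False by (metis mult_cancel_left)
    then show ?thesis using that xy by blast
  qed
qed

section \<open>Kaplansky's criterion and condition (3)\<close>

text \<open>The pair \<open>(p * a, p * b + q * c)\<close> is the row (p, q) times the matrix with
  rows (a, b) and (0, c).\<close>

definition kaplansky_condition :: "'a::comm_ring_1 itself \<Rightarrow> bool" where
  "kaplansky_condition _ \<longleftrightarrow>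
    (\<forall>a b c :: 'a. (\<exists>x y z. x * a + y * b + z * c = 1) \<longrightarrow>
      (\<exists>p q. (p * a, p * b + q * c) \<in> Um2))"

lemma kaplansky_condition_iff_Um2:
  "kaplansky_condition TYPE('a::comm_ring_1) \<longleftrightarrow>
    (\<forall>a b s :: 'a. \<exists>e f. (e, f) \<in> Um2 \<and> (a, e) \<in> Um2 \<and> (b * e + a * f, 1 - b * s - a) \<in> Um2)"
proof
  assume K: "kaplansky_condition TYPE('a)"
  show "\<forall>a b s :: 'a. \<exists>e f. (e, f) \<in> Um2 \<and> (a, e) \<in> Um2 \<and> (b * e + a * f, 1 - b * s - a) \<in> Um2"
  proof (intro allI)
    fix a b s :: 'a
    \<comment> \<open>The criterion is used for the triple (1 - b s - a, b, a); its p and q serve as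
      e and f.\<close>
    have "1 * (1 - b * s - a) + s * b + 1 * a = 1" by (simp add: algebra_simps)
    then obtain p q where pq: "(p * (1 - b * s - a), p * b + q * a) \<in> Um2"
      using K unfolding kaplansky_condition_def by blast
    \<comment> \<open>Unimodularity passes to the factors p and 1 - b s - a of the first entry.
      Modulo p the second entry is q a, so p is coprime to both q and a.\<close>
    have *: "(p, q * a + b * p) \<in> Um2" "(p * b + q * a, 1 - b * s - a) \<in> Um2"
      using pq Um2_commute Um2_dvd by (metis add.commute dvd_triv_left mult.commute,
          metis Um2_commute Um2_dvd dvd_triv_right)
    then have "(p, q * a) \<in> Um2" by (simp only: Um2_add_mult)
    then have "(p, q) \<in> Um2 \<and> (a, p) \<in> Um2"
      by (metis Um2_commute Um2_dvd dvd_triv_left dvd_triv_right)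
    with * show "\<exists>e f. (e, f) \<in> Um2 \<and> (a, e) \<in> Um2 \<and> (b * e + a * f, 1 - b * s - a) \<in> Um2"
      by (metis mult.commute)
  qed
next
  assume *: "\<forall>a b s :: 'a. \<exists>e f. (e, f) \<in> Um2 \<and> (a, e) \<in> Um2 \<and> (b * e + a * f, 1 - b * s - a) \<in> Um2"
  show "kaplansky_condition TYPE('a)"
    unfolding kaplansky_condition_def
  proof (intro allI impI)
    fix a b c :: 'a
    assume "\<exists>x y z. x * a + y * b + z * c = 1"
    then obtain x y z where xyz: "x * a + y * b + z * c = 1" by blast
    \<comment> \<open>With z c in the role of a and y in the role of s, the element 1 - b s - a
      becomes x a. Its factor x is dropped below, while z is absorbed into q = z f.\<close>
    obtain e f where ef: "(e, f) \<in> Um2" "(z * c, e) \<in> Um2"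
        "(b * e + z * c * f, 1 - b * y - z * c) \<in> Um2"
      using * by blast
    have "1 - b * y - z * c = x * a" using xyz by (simp add: algebra_simps flip: xyz)
    then have a: "(b * e + z * c * f, a) \<in> Um2" using ef(3) by (metis Um2_dvd dvd_triv_right)
    have "(e, f * (z * c)) \<in> Um2" using ef Um2_commute Um2_mult by blast
    then have "(e, f * (z * c) + b * e) \<in> Um2" by (simp only: Um2_add_mult)
    then have "(e * b + (z * f) * c, e) \<in> Um2" "(e * b + (z * f) * c, a) \<in> Um2"
      using a by (simp_all add: Um2_commute[of _ e] algebra_simps)
    then have "(e * a, e * b + (z * f) * c) \<in> Um2" using Um2_mult Um2_commute by blast
    then show "\<exists>p q. (p * a, p * b + q * c) \<in> Um2" by blast
  qed
qed

section \<open>Condition (2)\<close>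

text \<open>Take y1 to be a gcd of y and t: after cancelling it, \<open>Um2_if_mem\<close> makes y2
  coprime to a. Conversely, multiplying an identity k a + l y2 = 1 by t turns y2 t into a multiple
  of y.\<close>

lemma mem_iff_factorization:
  fixes a y t :: "'a::idom"
  assumes "bezout_domain TYPE('a)"
  shows "t \<in> {u * y + v * (a * t) | u v. True} \<longleftrightarrow>
    (\<exists>y1 y2. y = y1 * y2 \<and> y1 dvd t \<and> (a, y2) \<in> Um2)"
proof
  assume "t \<in> {u * y + v * (a * t) | u v. True}"
  then obtain u v where uv: "t = u * y + v * (a * t)" by blast
  obtain g y' t' k l where g: "y = g * y'" "t = g * t'" "k * y' + l * t' = 1"
    using bezout_domain_gcd[OF assms] by metis
  show "\<exists>y1 y2. y = y1 * y2 \<and> y1 dvd t \<and> (a, y2) \<in> Um2"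
  proof (cases "g = 0")
    case True
    then have "y = 0 * 1" "0 dvd t" using g by simp_all
    moreover have "(a, 1) \<in> Um2" by (simp add: Um2_iff exI[of _ 0])
    ultimately show ?thesis by blast
  next
    case False
    have "g * t' = g * (u * y' + v * (a * t'))" using uv unfolding g by (simp add: algebra_simps)
    then have "t' = u * y' + v * (a * t')" using False by simp
    then have "(a, y') \<in> Um2" using g(3) by (rule Um2_if_mem)
    moreover have "g dvd t" using g by simp
    ultimately show ?thesis using g(1) by blast
  qed
next
  assume "\<exists>y1 y2. y = y1 * y2 \<and> y1 dvd t \<and> (a, y2) \<in> Um2"
  then obtain y1 y2 w k l where yt: "y = y1 * y2" "t = y1 * w" and kl: "k * a + l * y2 = 1"
    unfolding Um2_iff dvd_def by blast
  have "(l * w) * y + k * (a * t) = y1 * w * (k * a + l * y2)"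
    unfolding yt by (simp add: algebra_simps)
  then have "t = (l * w) * y + k * (a * t)" using kl yt by simp
  then show "t \<in> {u * y + v * (a * t) | u v. True}" by blast
qed

text \<open>With \<open>w = 1 - a q - b r\<close> one has \<open>y = r + s w\<close>, \<open>t = q + w\<close> and
  \<open>b y + a t = 1 - w (1 - b s - a)\<close>; conversely, every \<open>(y, t, w)\<close> satisfying the last equation
  arises from \<open>q = t - w\<close> and \<open>r = y - s w\<close>.  The pairs \<open>(y, t)\<close> and \<open>(e, f)\<close> differ by a common
  factor.\<close>

lemma mem_condition_iff_Um2:
  fixes a b s :: "'a::idom"
  assumes "bezout_domain TYPE('a)"
  shows "(\<exists>q r. let y = r + s - a * s * q - b * s * r; t = 1 + q - a * q - b * r
      in t \<in> {u * y + v * (a * t) | u v. True}) \<longleftrightarrow>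
    (\<exists>e f. (e, f) \<in> Um2 \<and> (a, e) \<in> Um2 \<and> (b * e + a * f, 1 - b * s - a) \<in> Um2)"
    (is "?L \<longleftrightarrow> ?R")
proof
  assume ?L
  then obtain q r y t u v where y: "y = r + s - a * s * q - b * s * r"
    and t: "t = 1 + q - a * q - b * r" and uv: "t = u * y + v * (a * t)"
    unfolding Let_def by blast
  define c w where "c = 1 - b * s - a" and "w = 1 - a * q - b * r"
  have eq: "b * y + a * t = 1 - w * c"
    unfolding y t c_def w_def by (simp add: algebra_simps)
  obtain g e f k l where g: "y = g * e" "t = g * f" "k * e + l * f = 1"
    using bezout_domain_gcd[OF assms] by metis
  have ef: "(e, f) \<in> Um2" using g(3) by (auto simp: Um2_iff)
  show ?R
  proof (cases "g = 0")
    case True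
    \<comment> \<open>Here y = t = 0, so c is a unit and (e, f) = (1, 0) will do.\<close>
    then have "w * c = 1" using eq g by simp
    then have "0 * (b * 1 + a * 0) + w * c = 1" by simp
    then have "(b * 1 + a * 0, c) \<in> Um2" unfolding Um2_iff by blast
    moreover have "(1, 0) \<in> (Um2 :: ('a \<times> 'a) set)" "(a, 1) \<in> Um2"
      by (auto simp: Um2_iff intro: exI[of _ 0] exI[of _ 1])
    ultimately show ?thesis unfolding c_def by blast
  next
    case False
    have "g * f = g * (u * e + v * (a * f))" using uv unfolding g by (simp add: algebra_simps)
    then have "f = u * e + v * (a * f)" using False by simp
    then have "(a, e) \<in> Um2" using g(3) by (rule Um2_if_mem)
    moreover have "g * (b * e + a * f) + w * c = 1" using eq unfolding g(1,2) by (simp add: algebra_simps)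
    then have "(b * e + a * f, c) \<in> Um2" by (auto simp: Um2_iff)
    ultimately show ?thesis using ef unfolding c_def by blast
  qed
next
  assume ?R
  then obtain e f x z g w where xz: "x * a + z * e = 1"
    and gw: "g * (b * e + a * f) + w * (1 - b * s - a) = 1"
    by (auto simp: Um2_iff)
  \<comment> \<open>The prescribed values are y = g e and t = g f, with g and w the coefficients in
    the last unimodularity relation.\<close>
  define q r where "q = g * f - w" and "r = g * e - s * w"
  have w: "1 - a * q - b * r = w" using gw unfolding q_def r_def by (simp add: algebra_simps)
  have "r + s - a * s * q - b * s * r = r + s * (1 - a * q - b * r)"
    by (simp add: algebra_simps)
  then have y: "r + s - a * s * q - b * s * r = g * e"
    unfolding w by (simp add: r_def)
  have "1 + q - a * q - b * r = q + (1 - a * q - b * r)" by simp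
  then have t: "1 + q - a * q - b * r = g * f"
    unfolding w by (simp add: q_def)
  have "(z * f) * (g * e) + x * (a * (g * f)) = g * f * (x * a + z * e)"
    by (simp add: algebra_simps)
  then have "g * f = (z * f) * (g * e) + x * (a * (g * f))" using xz by simp
  then have "g * f \<in> {u * (g * e) + v * (a * (g * f)) | u v. True}" by blast
  then show ?L
    unfolding Let_def by (intro exI[of _ q] exI[of _ r]) (simp only: y t)
qed

section \<open>Combinations of rows and columns that preserve common divisors\<close>

text \<open>The invertible change of columns with columns (-x2', x1') and (s, t) sends the row x to
  (0, d) and the row y to (a, b). Kaplansky's criterion applies to the resulting triangular matrix
  once the gcd g of a, b, d is divided out.\<close>

lemma content_combination_2x2:
  fixes x1 x2 y1 y2 :: "'a::idom"
  assumes bez: "bezout_domain TYPE('a)" and K: "kaplansky_condition TYPE('a)"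
  obtains g p q v1 v2 where "p * (y1 * v1 + y2 * v2) + q * (x1 * v1 + x2 * v2) = g"
    "g dvd x1" "g dvd x2" "g dvd y1" "g dvd y2"
proof -
  obtain d x1' x2' s t where x: "x1 = d * x1'" "x2 = d * x2'" and st: "s * x1' + t * x2' = 1"
    using bezout_domain_gcd[OF bez] by metis
  define a b where "a = y2 * x1' - y1 * x2'" and "b = y1 * s + y2 * t"
  \<comment> \<open>Undoing the column change expresses y1 and y2 through a and b, so that divisors
    of a and b divide them too.\<close>
  have "b * x1' - a * t = y1 * (s * x1' + t * x2')" "b * x2' + a * s = y2 * (s * x1' + t * x2')"
    unfolding a_def b_def by (simp_all add: algebra_simps)
  then have y: "y1 = b * x1' - a * t" "y2 = b * x2' + a * s" using st by simp_all
  obtain h a1 b1 k l where h: "a = h * a1" "b = h * b1" "k * a1 + l * b1 = 1"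
    using bezout_domain_gcd[OF bez] by metis
  obtain g h' d' m n where g: "h = g * h'" "d = g * d'" "m * h' + n * d' = 1"
    using bezout_domain_gcd[OF bez] by metis
  have "(m * k) * (h' * a1) + (m * l) * (h' * b1) + n * d' = m * h' * (k * a1 + l * b1) + n * d'"
    by (simp add: algebra_simps)
  also have "\<dots> = 1" using g h by simp
  finally obtain p q where "(p * (h' * a1), p * (h' * b1) + q * d') \<in> Um2"
    using K unfolding kaplansky_condition_def by blast
  then obtain z w where zw: "z * (p * (h' * a1)) + w * (p * (h' * b1) + q * d') = 1"
    by (auto simp: Um2_iff)
  have "g * (z * (p * (h' * a1)) + w * (p * (h' * b1) + q * d')) = z * (p * a) + w * (p * b + q * d)"
    using g(1,2) h(1,2) by (simp add: algebra_simps)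
  then have gab: "z * (p * a) + w * (p * b + q * d) = g" using zw by simp
  \<comment> \<open>The vector (v1, v2) is z (-x2', x1') + w (s, t), the vector (z, w) carried back
    to the original columns.\<close>
  have "p * (y1 * (w * s - z * x2') + y2 * (w * t + z * x1')) +
      q * (x1 * (w * s - z * x2') + x2 * (w * t + z * x1')) =
      z * (p * a) + w * (p * b + q * (d * (s * x1' + t * x2')))"
    unfolding x a_def b_def by (simp add: algebra_simps)
  also have "\<dots> = g" using gab st by simp
  finally show thesis
  proof (rule that)
    show "g dvd x1" "g dvd x2" using g x by auto
    have "g dvd a" "g dvd b" using g h by auto
    then show "g dvd y1" "g dvd y2" unfolding y by auto
  qed
qed

text \<open>By induction the first n columns collapse to a single column (\<alpha>, \<beta>) with
  the same common divisors. Together with the new column it forms a 2 x 2 matrix, to which the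
  previous lemma applies. Speaking of divisors avoids choosing a gcd of all entries.\<close>

lemma two_row_content_combination:
  fixes x y :: "nat \<Rightarrow> 'a::idom"
  assumes bez: "bezout_domain TYPE('a)" and K: "kaplansky_condition TYPE('a)"
  shows "\<exists>v. \<forall>d. d dvd (\<Sum>j<n. x j * v j) \<longrightarrow> d dvd (\<Sum>j<n. y j * v j) \<longrightarrow>
    (\<forall>j<n. d dvd x j \<and> d dvd y j)"
proof (induction n)
  case 0
  then show ?case by simp
next
  case (Suc n)
  then obtain v where v: "\<And>d. d dvd (\<Sum>j<n. x j * v j) \<Longrightarrow> d dvd (\<Sum>j<n. y j * v j) \<Longrightarrow>
    (\<forall>j<n. d dvd x j \<and> d dvd y j)" by blast
  define \<alpha> \<beta> where "\<alpha> = (\<Sum>j<n. x j * v j)" and "\<beta> = (\<Sum>j<n. y j * v j)"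
  obtain g p q v1 v2 where g: "p * (\<beta> * v1 + y n * v2) + q * (\<alpha> * v1 + x n * v2) = g"
    "g dvd \<alpha>" "g dvd x n" "g dvd \<beta>" "g dvd y n"
    using content_combination_2x2[OF bez K] by metis
  define v' where "v' j = (if j < n then v1 * v j else v2)" for j
  have sums: "(\<Sum>j<Suc n. x j * v' j) = \<alpha> * v1 + x n * v2"
    "(\<Sum>j<Suc n. y j * v' j) = \<beta> * v1 + y n * v2"
    by (simp_all add: v'_def \<alpha>_def \<beta>_def sum_distrib_left mult_ac)
  show ?case
  proof (intro exI[of _ v'] allI impI)
    fix d j
    assume "d dvd (\<Sum>j<Suc n. x j * v' j)" "d dvd (\<Sum>j<Suc n. y j * v' j)" and j: "j < Suc n"
    then have "d dvd p * (\<beta> * v1 + y n * v2) + q * (\<alpha> * v1 + x n * v2)"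
      unfolding sums by (metis dvd_add dvd_mult)
    then have "d dvd g" by (simp only: g(1))
    then have "d dvd \<alpha>" "d dvd x n" "d dvd \<beta>" "d dvd y n" using g dvd_trans by blast+
    then show "d dvd x j \<and> d dvd y j"
      using v j unfolding \<alpha>_def \<beta>_def by (cases "j = n") auto
  qed
qed

text \<open>By induction the first m rows collapse to one row w with the same common divisors, which
  leaves the two rows w and \<open>A m\<close> to be merged.\<close>

lemma row_content_combination:
  fixes A :: "nat \<Rightarrow> nat \<Rightarrow> 'a::idom"
  assumes bez: "bezout_domain TYPE('a)" and K: "kaplansky_condition TYPE('a)"
  shows "\<exists>u. \<forall>d. (\<forall>j<n. d dvd (\<Sum>i<m. u i * A i j)) \<longrightarrow> (\<forall>i<m. \<forall>j<n. d dvd A i j)"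
proof (induction m)
  case 0
  then show ?case by simp
next
  case (Suc m)
  then obtain u where u: "\<And>d i j. \<forall>j<n. d dvd (\<Sum>i<m. u i * A i j) \<Longrightarrow> i < m \<Longrightarrow> j < n \<Longrightarrow> d dvd A i j"
    by blast
  define w where "w j = (\<Sum>i<m. u i * A i j)" for j
  obtain v where v: "\<And>d j. d dvd (\<Sum>j<n. w j * v j) \<Longrightarrow> d dvd (\<Sum>j<n. A m j * v j) \<Longrightarrow>
    j < n \<Longrightarrow> d dvd w j \<and> d dvd A m j"
    using two_row_content_combination[OF bez K, where n = n and x = w and y = "A m"] by blast
  \<comment> \<open>The vector v only serves to find s and t: the row s w + t \<open>A m\<close> has
    product g with v, so a common divisor of its entries divides g, hence both products with v,
    hence both rows.\<close>
  obtain g \<alpha> \<beta> s t where g: "(\<Sum>j<n. w j * v j) = g * \<alpha>" "(\<Sum>j<n. A m j * v j) = g * \<beta>"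
    "s * \<alpha> + t * \<beta> = 1"
    by (rule bezout_domain_gcd[OF bez])
  define u' where "u' i = (if i < m then s * u i else t)" for i
  have w': "(\<Sum>i<Suc m. u' i * A i j) = s * w j + t * A m j" for j
    by (simp add: u'_def w_def sum_distrib_left mult_ac)
  show ?case
  proof (intro exI[of _ u'] allI impI)
    fix d i j
    assume d: "\<forall>j<n. d dvd (\<Sum>i<Suc m. u' i * A i j)" and ij: "i < Suc m" "j < n"
    have "d dvd (\<Sum>j<n. (s * w j + t * A m j) * v j)"
      using d unfolding w' by (intro dvd_sum) auto
    also have "(\<Sum>j<n. (s * w j + t * A m j) * v j) =
        s * (\<Sum>j<n. w j * v j) + t * (\<Sum>j<n. A m j * v j)"
      by (simp add: sum.distrib sum_distrib_left algebra_simps)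
    also have "\<dots> = s * (g * \<alpha>) + t * (g * \<beta>)" by (simp only: g(1,2))
    also have "\<dots> = g * (s * \<alpha> + t * \<beta>)" by (simp add: algebra_simps)
    finally have "d dvd g" using g(3) by simp
    then have "d dvd w j \<and> d dvd A m j" if "j < n" for j
      using v that unfolding g by simp
    then show "d dvd A i j"
      using u[of d i j] ij unfolding w_def by (cases "i = m") auto
  qed
qed

section \<open>Invertible matrices and completion of rows\<close>

lemma invertible_mat_iff:
  assumes "A \<in> carrier_mat n n"
  shows "invertible_mat A \<longleftrightarrow> (\<exists>B \<in> carrier_mat n n. A * B = 1\<^sub>m n \<and> B * A = 1\<^sub>m n)"
proof
  assume "invertible_mat A"
  then obtain B where B: "A * B = 1\<^sub>m (dim_row A)" "B * A = 1\<^sub>m (dim_row B)"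
    by (auto simp: invertible_mat_def inverts_mat_def)
  \<comment> \<open>The shape of the inverse is read off from the column counts of the two
    identities.\<close>
  have "dim_row B = n" "dim_col B = n"
    using arg_cong[OF B(1), of dim_col] arg_cong[OF B(2), of dim_col] assms by auto
  then show "\<exists>B \<in> carrier_mat n n. A * B = 1\<^sub>m n \<and> B * A = 1\<^sub>m n"
    using B assms by (intro bexI[of _ B]) auto
next
  assume "\<exists>B \<in> carrier_mat n n. A * B = 1\<^sub>m n \<and> B * A = 1\<^sub>m n"
  then show "invertible_mat A"
    using assms by (auto simp: invertible_mat_def inverts_mat_def)
qed

lemma invertible_mat_one: "invertible_mat (1\<^sub>m n)"
  by (subst invertible_mat_iff[of _ n]) (auto intro: bexI[of _ "1\<^sub>m n"])

lemma invertible_mat_mult: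
  fixes A B :: "'a::comm_ring_1 mat"
  assumes AB: "A \<in> carrier_mat n n" "B \<in> carrier_mat n n" and "invertible_mat A" "invertible_mat B"
  shows "invertible_mat (A * B)"
proof -
  obtain A' B' where A': "A' \<in> carrier_mat n n" "A * A' = 1\<^sub>m n" "A' * A = 1\<^sub>m n"
    and B': "B' \<in> carrier_mat n n" "B * B' = 1\<^sub>m n" "B' * B = 1\<^sub>m n"
    using assms invertible_mat_iff by metis
  have "(A * B) * (B' * A') = A * ((B * B') * A')" "(B' * A') * (A * B) = B' * ((A' * A) * B)"
    using AB A'(1) B'(1) by (simp_all add: assoc_mult_mat[of _ n n _ n _ n])
  then have "(A * B) * (B' * A') = 1\<^sub>m n" "(B' * A') * (A * B) = 1\<^sub>m n"
    using AB A' B' by simp_all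
  moreover have "B' * A' \<in> carrier_mat n n" using A' B' by auto
  ultimately show ?thesis
    using AB by (subst invertible_mat_iff[of _ n]) auto
qed

lemma invertible_mat_transpose:
  fixes A :: "'a::comm_ring_1 mat"
  assumes A: "A \<in> carrier_mat n n" and "invertible_mat A"
  shows "invertible_mat (transpose_mat A)"
proof -
  obtain B where B: "B \<in> carrier_mat n n" "A * B = 1\<^sub>m n" "B * A = 1\<^sub>m n"
    using assms invertible_mat_iff by metis
  have "transpose_mat A * transpose_mat B = 1\<^sub>m n" "transpose_mat B * transpose_mat A = 1\<^sub>m n"
    unfolding transpose_mult[OF B(1) A, symmetric] transpose_mult[OF A B(1), symmetric]
    using B by simp_all
  moreover have "transpose_mat B \<in> carrier_mat n n" using B by simp
  ultimately show ?thesis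
    using A by (subst invertible_mat_iff[of _ n]) auto
qed

abbreviation block_diag :: "'a::comm_ring_1 mat \<Rightarrow> 'a mat \<Rightarrow> 'a mat" where
  "block_diag A B \<equiv> four_block_mat A (0\<^sub>m (dim_row A) (dim_col B)) (0\<^sub>m (dim_row B) (dim_col A)) B"

lemma mult_block_diag:
  assumes "A \<in> carrier_mat m1 n1" "B \<in> carrier_mat m2 n2" "A' \<in> carrier_mat n1 k1" "B' \<in> carrier_mat n2 k2"
  shows "block_diag A B * block_diag A' B' = block_diag (A * A') (B * B')"
  using assms by (subst mult_four_block_mat[of _ m1 n1 _ n2 _ m2 _ _ k1 _ k2]) auto

lemma invertible_mat_block_diag:
  assumes AB: "A \<in> carrier_mat m m" "B \<in> carrier_mat n n" and "invertible_mat A" "invertible_mat B"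
  shows "invertible_mat (block_diag A B)"
proof -
  obtain A' B' where A': "A' \<in> carrier_mat m m" "A * A' = 1\<^sub>m m" "A' * A = 1\<^sub>m m"
    and B': "B' \<in> carrier_mat n n" "B * B' = 1\<^sub>m n" "B' * B = 1\<^sub>m n"
    using assms invertible_mat_iff by metis
  have "block_diag A B * block_diag A' B' = 1\<^sub>m (m + n)"
    "block_diag A' B' * block_diag A B = 1\<^sub>m (m + n)"
    using mult_block_diag[OF AB A'(1) B'(1)] mult_block_diag[OF A'(1) B'(1) AB] A' B' by simp_all
  moreover have "block_diag A B \<in> carrier_mat (m + n) (m + n)"
    "block_diag A' B' \<in> carrier_mat (m + n) (m + n)" using AB A' B' by auto
  ultimately show ?thesis by (subst invertible_mat_iff[of _ "m + n"]) auto
qed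

text \<open>Multiplying such matrices adds their lower left blocks, so the inverse has block
  -C.\<close>

lemma invertible_mat_lower_unitriangular:
  fixes C :: "'a::comm_ring_1 mat"
  assumes C: "C \<in> carrier_mat n m"
  shows "invertible_mat (four_block_mat (1\<^sub>m m) (0\<^sub>m m n) C (1\<^sub>m n))"
proof -
  define L where "L X = four_block_mat (1\<^sub>m m) (0\<^sub>m m n) X (1\<^sub>m n)" for X :: "'a mat"
  have L: "L X * L Y = L (X + Y)" if "X \<in> carrier_mat n m" "Y \<in> carrier_mat n m" for X Y
    using that unfolding L_def by (subst mult_four_block_mat[of _ m m _ n _ n _ _ m _ n]) auto
  have "L (0\<^sub>m n m) = 1\<^sub>m (m + n)" by (simp add: L_def)
  then have "L C * L (- C) = 1\<^sub>m (m + n)" "L (- C) * L C = 1\<^sub>m (m + n)"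
    using L[of C "- C"] L[of "- C" C] C
    by (simp_all add: add_uminus_minus_mat[of C n m] uminus_l_inv_mat[of C n m])
  moreover have "L X \<in> carrier_mat (m + n) (m + n)" for X by (simp add: L_def)
  ultimately show ?thesis
    unfolding L_def[symmetric] by (subst invertible_mat_iff[of _ "m + n"]) auto
qed

lemma invertible_mat_upper_unitriangular:
  fixes B :: "'a::comm_ring_1 mat"
  assumes B: "B \<in> carrier_mat m n"
  shows "invertible_mat (four_block_mat (1\<^sub>m m) B (0\<^sub>m n m) (1\<^sub>m n))"
proof -
  have "four_block_mat (1\<^sub>m m) B (0\<^sub>m n m) (1\<^sub>m n) =
      transpose_mat (four_block_mat (1\<^sub>m m) (0\<^sub>m m n) (transpose_mat B) (1\<^sub>m n))"
    using B by (subst transpose_four_block_mat[of _ m m _ n _ n]) auto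
  then show ?thesis
    using B invertible_mat_lower_unitriangular[of "transpose_mat B" n m]
    by (simp add: invertible_mat_transpose[of _ "m + n"])
qed

text \<open>The determinant is 1, so the adjugate is the inverse.\<close>

lemma invertible_mat_2x2:
  fixes a b c d :: "'a::comm_ring_1"
  assumes "a * d - b * c = 1"
  shows "invertible_mat (mat_of_rows_list 2 [[a, b], [c, d]])"
proof -
  have "mat_of_rows_list 2 [[a, b], [c, d]] * mat_of_rows_list 2 [[d, - b], [- c, a]] = 1\<^sub>m 2"
    "mat_of_rows_list 2 [[d, - b], [- c, a]] * mat_of_rows_list 2 [[a, b], [c, d]] = 1\<^sub>m 2"
    using assms
    by (auto intro!: eq_matI simp: mat_of_rows_list_def scalar_prod_def numeral_2_eq_2 less_Suc_eq algebra_simps)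
  moreover have "mat_of_rows_list 2 [[d, - b], [- c, a]] \<in> carrier_mat 2 2"
    "mat_of_rows_list 2 [[a, b], [c, d]] \<in> carrier_mat 2 2"
    by (auto simp: mat_of_rows_list_def)
  ultimately show ?thesis by (subst invertible_mat_iff[of _ 2]) auto
qed

text \<open>This realises u, up to a scalar, as the top row of an invertible matrix. The tail of u
  is d times such a row, and a 2 x 2 block of determinant 1 merges d with
  \<open>u 0\<close>.\<close>

lemma invertible_completion:
  fixes u :: "nat \<Rightarrow> 'a::idom"
  assumes bez: "bezout_domain TYPE('a)"
  shows "\<exists>P d. P \<in> carrier_mat (Suc n) (Suc n) \<and> invertible_mat P \<and> (\<forall>j<Suc n. u j = d * P $$ (0, j))"
proof (induction n arbitrary: u)
  case 0
  then show ?case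
    by (intro exI[of _ "1\<^sub>m 1"] exI[of _ "u 0"]) (auto simp: invertible_mat_one)
next
  case (Suc n)
  obtain P d where P: "P \<in> carrier_mat (Suc n) (Suc n)" "invertible_mat P"
    and d: "\<And>j. j < Suc n \<Longrightarrow> u (Suc j) = d * P $$ (0, j)"
    using Suc.IH[of "\<lambda>j. u (Suc j)"] by blast
  obtain g x y s t where g: "u 0 = g * x" "d = g * y" "s * x + t * y = 1"
    using bezout_domain_gcd[OF bez] by metis
  \<comment> \<open>The top row of E is (x, y, 0, ..., 0), so that of E F is x followed by y times
    the top row of P; multiplying by g gives u.\<close>
  define E where "E = block_diag (mat_of_rows_list 2 [[x, y], [- t, s]]) (1\<^sub>m n)"
  define F where "F = block_diag (1\<^sub>m 1) P"
  have E: "E \<in> carrier_mat (Suc (Suc n)) (Suc (Suc n))" and F: "F \<in> carrier_mat (Suc (Suc n)) (Suc (Suc n))"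
    using P by (auto simp: E_def F_def mat_of_rows_list_def)
  have "x * s - y * (- t) = 1" using g by (simp add: algebra_simps)
  then have "invertible_mat E"
    unfolding E_def by (intro invertible_mat_block_diag[of _ 2 _ n] invertible_mat_2x2 invertible_mat_one)
      (auto simp: mat_of_rows_list_def)
  moreover have "invertible_mat F"
    unfolding F_def using P by (intro invertible_mat_block_diag[of _ 1 _ "Suc n"] invertible_mat_one) auto
  ultimately have "invertible_mat (E * F)"
    using E F invertible_mat_mult by blast
  moreover have "E * F \<in> carrier_mat (Suc (Suc n)) (Suc (Suc n))" using E F by auto
  moreover have "u j = g * (E * F) $$ (0, j)" if j: "j < Suc (Suc n)" for j
  proof -
    have E0: "E $$ (0, 0) = x" "E $$ (0, Suc 0) = y" "\<And>k. k < n \<Longrightarrow> E $$ (0, Suc (Suc k)) = 0"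
      by (auto simp: E_def mat_of_rows_list_def)
    have "(E * F) $$ (0, j) = (\<Sum>k<Suc (Suc n). E $$ (0, k) * F $$ (k, j))"
      using E F j by (simp add: scalar_prod_def lessThan_atLeast0 del: sum.lessThan_Suc sum.op_ivl_Suc)
    also have "\<dots> = x * F $$ (0, j) + y * F $$ (1, j)"
      by (simp add: sum.lessThan_Suc_shift E0 del: sum.lessThan_Suc)
    finally show ?thesis
      using d[of "j - 1"] g j P by (cases j) (auto simp: F_def mult_ac)
  qed
  ultimately show ?case by blast
qed

section \<open>Equivalence of matrices\<close>

lemma mat_equiv_refl: "mat_equiv A A"
  unfolding mat_equiv_def
  by (intro exI[of _ "1\<^sub>m (dim_row A)"] exI[of _ "1\<^sub>m (dim_col A)"]) (auto simp: invertible_mat_one)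

lemma mat_equiv_carrier: "mat_equiv A B \<Longrightarrow> A \<in> carrier_mat m n \<Longrightarrow> B \<in> carrier_mat m n"
  by (auto simp: mat_equiv_def)

lemma mat_equiv_trans:
  assumes "mat_equiv A B" "mat_equiv B C"
  shows "mat_equiv A C"
proof -
  define m n where "m = dim_row A" and "n = dim_col A"
  have A: "A \<in> carrier_mat m n" by (simp add: m_def n_def)
  obtain P Q where PQ: "P \<in> carrier_mat m m" "invertible_mat P" "Q \<in> carrier_mat n n" "invertible_mat Q"
    "B = P * A * Q"
    using assms(1) unfolding mat_equiv_def m_def n_def by blast
  have B: "dim_row B = m" "dim_col B = n" using PQ by auto
  obtain R S where RS: "R \<in> carrier_mat m m" "invertible_mat R" "S \<in> carrier_mat n n" "invertible_mat S"
    "C = R * B * S"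
    using assms(2) unfolding mat_equiv_def B by blast
  have "C = (R * P) * A * (Q * S)"
    using A PQ(1,3) RS(1,3) unfolding RS(5) PQ(5)
    by (simp add: assoc_mult_mat[of _ m m _ m _ n] assoc_mult_mat[of _ m m _ n _ n] assoc_mult_mat[of _ m n _ n _ n])
  then show ?thesis
    unfolding mat_equiv_def m_def[symmetric] n_def[symmetric]
    using PQ RS by (intro exI[of _ "R * P"] exI[of _ "Q * S"]) (auto intro!: invertible_mat_mult)
qed

lemma mat_equiv_sym:
  assumes "mat_equiv A B"
  shows "mat_equiv B A"
proof -
  define m n where "m = dim_row A" and "n = dim_col A"
  have A: "A \<in> carrier_mat m n" by (simp add: m_def n_def)
  obtain P Q where PQ: "P \<in> carrier_mat m m" "invertible_mat P" "Q \<in> carrier_mat n n" "invertible_mat Q"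
    "B = P * A * Q"
    using assms unfolding mat_equiv_def m_def n_def by blast
  obtain P' Q' where P': "P' \<in> carrier_mat m m" "P * P' = 1\<^sub>m m" "P' * P = 1\<^sub>m m"
    and Q': "Q' \<in> carrier_mat n n" "Q * Q' = 1\<^sub>m n" "Q' * Q = 1\<^sub>m n"
    using PQ invertible_mat_iff by metis
  have "P' * B * Q' = (P' * P) * A * (Q * Q')"
    using A PQ(1,3) P'(1) Q'(1) unfolding PQ(5)
    by (simp add: assoc_mult_mat[of _ m m _ m _ n] assoc_mult_mat[of _ m m _ n _ n] assoc_mult_mat[of _ m n _ n _ n])
  then have "A = P' * B * Q'" using A P' Q' by simp
  moreover have "dim_row B = m" "dim_col B = n" using PQ by auto
  moreover have "invertible_mat P'" "invertible_mat Q'"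
    using P' Q' PQ invertible_mat_iff by metis+
  ultimately show ?thesis
    unfolding mat_equiv_def using P' Q' by metis
qed

text \<open>The entries of P A Q are linear combinations of those of A. With
  \<open>mat_equiv_sym\<close>, equivalent matrices have the same common divisors.\<close>

lemma mat_equiv_dvd:
  fixes A :: "'a::comm_ring_1 mat"
  assumes "mat_equiv A B" and h: "\<forall>i<dim_row A. \<forall>j<dim_col A. h dvd A $$ (i, j)"
  shows "\<forall>i<dim_row B. \<forall>j<dim_col B. h dvd B $$ (i, j)"
proof -
  obtain P Q where PQ: "P \<in> carrier_mat (dim_row A) (dim_row A)" "Q \<in> carrier_mat (dim_col A) (dim_col A)"
    "B = P * A * Q"
    using assms(1) unfolding mat_equiv_def by blast
  have "\<forall>i<dim_row A. \<forall>j<dim_col A. h dvd (P * A) $$ (i, j)"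
    using PQ h by (auto simp: scalar_prod_def intro!: dvd_sum)
  then show ?thesis
    using PQ by (auto simp: scalar_prod_def intro!: dvd_sum)
qed

lemma mat_equiv_block_diag:
  assumes "mat_equiv B C"
  shows "mat_equiv (block_diag A B) (block_diag A C)"
proof -
  define m n where "m = dim_row B" and "n = dim_col B"
  define k l where "k = dim_row A" and "l = dim_col A"
  have B: "B \<in> carrier_mat m n" and A: "A \<in> carrier_mat k l" by (simp_all add: m_def n_def k_def l_def)
  obtain P Q where PQ: "P \<in> carrier_mat m m" "invertible_mat P" "Q \<in> carrier_mat n n" "invertible_mat Q"
    "C = P * B * Q"
    using assms unfolding mat_equiv_def m_def n_def by blast
  have C: "dim_row C = m" "dim_col C = n" using PQ by auto
  have "block_diag (1\<^sub>m k) P * block_diag A B * block_diag (1\<^sub>m l) Q = block_diag (1\<^sub>m k * A) (P * B) * block_diag (1\<^sub>m l) Q"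
    using A B PQ by (subst mult_block_diag[of _ k k _ m m _ l _ n]) auto
  also have "\<dots> = block_diag (1\<^sub>m k * A * 1\<^sub>m l) (P * B * Q)"
    using A B PQ by (intro mult_block_diag[of _ k l _ m n _ l _ n]) auto
  also have "\<dots> = block_diag A C"
    using A PQ by simp
  finally have "block_diag A C = block_diag (1\<^sub>m k) P * block_diag A B * block_diag (1\<^sub>m l) Q" ..
  moreover have "block_diag (1\<^sub>m k) P \<in> carrier_mat (k + m) (k + m)"
    "block_diag (1\<^sub>m l) Q \<in> carrier_mat (l + n) (l + n)" using PQ by auto
  moreover have "invertible_mat (block_diag (1\<^sub>m k) P)" "invertible_mat (block_diag (1\<^sub>m l) Q)"
    using PQ invertible_mat_block_diag invertible_mat_one by (metis one_carrier_mat)+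
  moreover have "dim_row (block_diag A B) = k + m" "dim_col (block_diag A B) = l + n"
    using A B by auto
  ultimately show ?thesis unfolding mat_equiv_def by metis
qed

section \<open>Reduction to diagonal form\<close>

lemma mat_equiv_content_corner:
  fixes A :: "'a::idom mat"
  assumes bez: "bezout_domain TYPE('a)" and K: "kaplansky_condition TYPE('a)"
    and A: "A \<in> carrier_mat (Suc m) (Suc n)"
  obtains B where "mat_equiv A B" "\<And>i j. i < Suc m \<Longrightarrow> j < Suc n \<Longrightarrow> B $$ (0, 0) dvd B $$ (i, j)"
proof -
  obtain u where u: "\<And>d i j. (\<forall>j<Suc n. d dvd (\<Sum>i<Suc m. u i * A $$ (i, j))) \<Longrightarrow>
      i < Suc m \<Longrightarrow> j < Suc n \<Longrightarrow> d dvd A $$ (i, j)"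
    using row_content_combination[OF bez K, where n = "Suc n" and m = "Suc m" and A = "\<lambda>i j. A $$ (i, j)"] by blast
  define w where "w j = (\<Sum>i<Suc m. u i * A $$ (i, j))" for j
  \<comment> \<open>Two equal rows w turn the two-row lemma into a statement about one row: the
    product of w and v divides every entry of w.\<close>
  obtain v where v0: "\<And>d j. d dvd (\<Sum>j<Suc n. w j * v j) \<Longrightarrow> j < Suc n \<Longrightarrow> d dvd w j"
    using two_row_content_combination[OF bez K, where n = "Suc n" and x = w and y = w] by blast
  have v: "(\<Sum>j<Suc n. w j * v j) dvd w j" if "j < Suc n" for j
    using dvd_refl that by (rule v0)
  obtain P d where P: "P \<in> carrier_mat (Suc m) (Suc m)" "invertible_mat P"
    and d: "\<And>i. i < Suc m \<Longrightarrow> u i = d * P $$ (0, i)"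
    using invertible_completion[OF bez, of m u] by blast
  obtain Q e where Q: "Q \<in> carrier_mat (Suc n) (Suc n)" "invertible_mat Q"
    and e: "\<And>j. j < Suc n \<Longrightarrow> v j = e * Q $$ (0, j)"
    using invertible_completion[OF bez, of n v] by blast
  \<comment> \<open>The completion yields rows, but v acts as a column; hence the transpose. The
    corner of B times d e is then u A v, which divides all entries of A.\<close>
  define B where "B = P * A * transpose_mat Q"
  have AB: "mat_equiv A B"
    unfolding mat_equiv_def B_def using A P Q
    by (intro exI[of _ P] exI[of _ "transpose_mat Q"]) (auto intro: invertible_mat_transpose)
  have "B $$ (0, 0) = (\<Sum>j<Suc n. (\<Sum>i<Suc m. P $$ (0, i) * A $$ (i, j)) * Q $$ (0, j))"
    using A P Q unfolding B_def
    by (simp add: scalar_prod_def lessThan_atLeast0 del: sum.lessThan_Suc sum.op_ivl_Suc assoc_mult_mat)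
  then have "d * e * B $$ (0, 0) = (\<Sum>j<Suc n. w j * v j)"
    by (simp add: w_def d e sum_distrib_left sum_distrib_right mult_ac
        del: sum.lessThan_Suc cong: sum.cong_simp)
  then have "B $$ (0, 0) dvd (\<Sum>j<Suc n. w j * v j)" using dvd_triv_right[of "B $$ (0, 0)" "d * e"] by simp
  then have "B $$ (0, 0) dvd A $$ (i, j)" if "i < Suc m" "j < Suc n" for i j
    using u v that dvd_trans unfolding w_def by blast
  then have "\<forall>i<dim_row B. \<forall>j<dim_col B. B $$ (0, 0) dvd B $$ (i, j)"
    using A by (intro mat_equiv_dvd[OF AB]) auto
  moreover have "B \<in> carrier_mat (Suc m) (Suc n)" using mat_equiv_carrier[OF AB A] .
  ultimately show thesis using that[OF AB] by auto
qed

text \<open>Since h divides the first row and column, B factors as L times a block diagonal matrix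
  times U with unitriangular L and U. The remaining block is B minus the rank one term h c r, so h
  still divides it.\<close>

lemma mat_equiv_split_corner:
  fixes B :: "'a::comm_ring_1 mat"
  assumes B: "B \<in> carrier_mat (Suc m) (Suc n)"
    and corner: "\<And>i j. i < Suc m \<Longrightarrow> j < Suc n \<Longrightarrow> B $$ (0, 0) dvd B $$ (i, j)"
  obtains A where "A \<in> carrier_mat m n" "mat_equiv B (block_diag (mat 1 1 (\<lambda>_. B $$ (0, 0))) A)"
    "\<And>i j. i < m \<Longrightarrow> j < n \<Longrightarrow> B $$ (0, 0) dvd A $$ (i, j)"
proof -
  define h where "h = B $$ (0, 0)"
  have "\<forall>i. \<exists>x. i < m \<longrightarrow> B $$ (Suc i, 0) = h * x" "\<forall>j. \<exists>x. j < n \<longrightarrow> B $$ (0, Suc j) = h * x"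
    using corner unfolding h_def by (meson dvdE Suc_less_eq zero_less_Suc)+
  then obtain c r where c: "\<And>i. i < m \<Longrightarrow> B $$ (Suc i, 0) = h * c i"
    and r: "\<And>j. j < n \<Longrightarrow> B $$ (0, Suc j) = h * r j" by metis
  define C where "C = mat m 1 (\<lambda>(i, _). c i)"
  define R where "R = mat 1 n (\<lambda>(_, j). r j)"
  define H where "H = mat 1 1 (\<lambda>_. h)"
  define A where "A = mat m n (\<lambda>(i, j). B $$ (Suc i, Suc j) - h * c i * r j)"
  define L where "L = four_block_mat (1\<^sub>m 1) (0\<^sub>m 1 m) C (1\<^sub>m m)"
  define U where "U = four_block_mat (1\<^sub>m 1) R (0\<^sub>m n 1) (1\<^sub>m n)"
  have car: "C \<in> carrier_mat m 1" "R \<in> carrier_mat 1 n" "H \<in> carrier_mat 1 1" "A \<in> carrier_mat m n"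
    by (auto simp: C_def R_def H_def A_def)
  have "L * block_diag H A = four_block_mat H (0\<^sub>m 1 n) (C * H) A"
    using car unfolding L_def by (subst mult_four_block_mat[of _ 1 1 _ m _ m _ _ 1 _ n]) auto
  then have "L * block_diag H A * U = four_block_mat H (H * R) (C * H) (C * H * R + A)"
    using car unfolding U_def by (simp add: mult_four_block_mat[of _ 1 1 _ n _ m _ _ 1 _ n])
  also have "\<dots> = B"
  proof (rule eq_matI)
    fix i j
    assume "i < dim_row B" "j < dim_col B"
    then show "four_block_mat H (H * R) (C * H) (C * H * R + A) $$ (i, j) = B $$ (i, j)"
      using B car by (cases i; cases j)
        (auto simp: H_def R_def C_def A_def scalar_prod_def c r h_def mult_ac)
  qed (use B car in auto)
  finally have "B = L * block_diag H A * U" ..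
  moreover have "invertible_mat L" "invertible_mat U"
    unfolding L_def U_def using car
    by (auto intro: invertible_mat_lower_unitriangular invertible_mat_upper_unitriangular)
  moreover have "L \<in> carrier_mat (Suc m) (Suc m)" "U \<in> carrier_mat (Suc n) (Suc n)"
    "dim_row (block_diag H A) = Suc m" "dim_col (block_diag H A) = Suc n"
    using car by (auto simp: L_def U_def)
  ultimately have "mat_equiv (block_diag H A) B" unfolding mat_equiv_def by metis
  then have "mat_equiv B (block_diag H A)" by (rule mat_equiv_sym)
  moreover have "h dvd A $$ (i, j)" if "i < m" "j < n" for i j
    using that corner unfolding A_def h_def by simp
  ultimately show thesis using that car unfolding H_def h_def by blast
qed

lemma smith_normal_form:
  fixes A :: "'a::idom mat"
  assumes bez: "bezout_domain TYPE('a)" and K: "kaplansky_condition TYPE('a)"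
    and "A \<in> carrier_mat m n"
  shows "\<exists>D. mat_equiv A D \<and> diagonal_mat D \<and>
    (\<forall>i. i + 1 < min m n \<longrightarrow> D $$ (i, i) dvd D $$ (i + 1, i + 1))"
  using assms(3)
proof (induction m arbitrary: n A)
  case 0
  then show ?case by (intro exI[of _ A]) (auto simp: mat_equiv_refl diagonal_mat_def)
next
  case (Suc m)
  show ?case
  proof (cases n)
    case 0
    then show ?thesis using Suc.prems by (intro exI[of _ A]) (auto simp: mat_equiv_refl diagonal_mat_def)
  next
    case n: (Suc k)
    obtain B where AB: "mat_equiv A B" and corner: "\<And>i j. i < Suc m \<Longrightarrow> j < Suc k \<Longrightarrow> B $$ (0, 0) dvd B $$ (i, j)"
      using mat_equiv_content_corner[OF bez K] Suc.prems unfolding n by metis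
    define H where "H = mat 1 1 (\<lambda>_. B $$ (0, 0))"
    have "B \<in> carrier_mat (Suc m) (Suc k)" using mat_equiv_carrier[OF AB] Suc.prems n by simp
    then obtain A' where A': "A' \<in> carrier_mat m k" "mat_equiv B (block_diag H A')"
      "\<And>i j. i < m \<Longrightarrow> j < k \<Longrightarrow> B $$ (0, 0) dvd A' $$ (i, j)"
      using mat_equiv_split_corner corner unfolding H_def by metis
    obtain D where D: "mat_equiv A' D" "diagonal_mat D"
      "\<And>i. i + 1 < min m k \<Longrightarrow> D $$ (i, i) dvd D $$ (i + 1, i + 1)"
      using Suc.IH[OF A'(1)] by blast
    have Dc: "D \<in> carrier_mat m k" using mat_equiv_carrier[OF D(1) A'(1)] .
    \<comment> \<open>The corner divides A' and hence the equivalent D, which supplies the first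
      link of the divisibility chain.\<close>
    have dvd: "\<forall>i<dim_row D. \<forall>j<dim_col D. B $$ (0, 0) dvd D $$ (i, j)"
      using A' by (intro mat_equiv_dvd[OF D(1)]) auto
    have "mat_equiv A (block_diag H D)"
      using AB A'(2) mat_equiv_block_diag[OF D(1)] mat_equiv_trans by blast
    moreover have "diagonal_mat (block_diag H D)"
      using D(2) unfolding diagonal_mat_def by (auto simp: H_def)
    \<comment> \<open>For i > 0 the diagonal position i lies at position i - 1 of D; for i = 0 the
      corner meets the first diagonal entry of D.\<close>
    moreover have "block_diag H D $$ (i, i) dvd block_diag H D $$ (i + 1, i + 1)" if "i + 1 < min (Suc m) n" for i
      using that n Dc dvd D(3)[of "i - 1"] by (cases i) (auto simp: H_def)
    ultimately show ?thesis by blast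
  qed
qed

section \<open>Elementary divisor rings and Kaplansky's criterion\<close>

text \<open>For the forward direction, diagonalise the matrix with rows (a, b) and (0, c). The first
  diagonal entry divides a, b and c, so it is a unit; it is also the first row of P times A times
  the first column of Q.\<close>

lemma elementary_divisor_ring_iff_kaplansky_condition:
  assumes bez: "bezout_domain TYPE('a::idom)"
  shows "elementary_divisor_ring TYPE('a) \<longleftrightarrow> kaplansky_condition TYPE('a)"
proof
  assume "kaplansky_condition TYPE('a)"
  then show "elementary_divisor_ring TYPE('a)"
    unfolding elementary_divisor_ring_def using smith_normal_form[OF bez] by blast
next
  assume edr: "elementary_divisor_ring TYPE('a)"
  show "kaplansky_condition TYPE('a)"
    unfolding kaplansky_condition_def
  proof (intro allI impI)
    fix a b c :: 'a
    assume "\<exists>x y z. x * a + y * b + z * c = 1"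
    then obtain x y z where xyz: "x * a + y * b + z * c = 1" by blast
    define A where "A = mat_of_rows_list 2 [[a, b], [0, c]]"
    have A: "A \<in> carrier_mat 2 2" by (auto simp: A_def mat_of_rows_list_def)
    have A_simps: "A $$ (0, 0) = a" "A $$ (0, 1) = b" "A $$ (1, 0) = 0" "A $$ (1, 1) = c"
      by (auto simp: A_def mat_of_rows_list_def)
    obtain D where AD: "mat_equiv A D" and D: "diagonal_mat D"
      and dvd: "\<And>i. i + 1 < min 2 2 \<Longrightarrow> D $$ (i, i) dvd D $$ (i + 1, i + 1)"
      using edr A unfolding elementary_divisor_ring_def by (metis one_le_numeral)
    have Dc: "D \<in> carrier_mat 2 2" using mat_equiv_carrier[OF AD A] .
    have "\<forall>i<dim_row D. \<forall>j<dim_col D. D $$ (0, 0) dvd D $$ (i, j)"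
      using D Dc dvd[of 0] by (auto simp: diagonal_mat_def numeral_2_eq_2 less_Suc_eq)
    then have "\<forall>i<dim_row A. \<forall>j<dim_col A. D $$ (0, 0) dvd A $$ (i, j)"
      using mat_equiv_dvd[OF mat_equiv_sym[OF AD]] by blast
    then have "D $$ (0, 0) dvd a" "D $$ (0, 0) dvd b" "D $$ (0, 0) dvd c"
      using A A_simps by (metis carrier_matD one_less_numeral_iff semiring_norm(76) zero_less_numeral)+
    then have "D $$ (0, 0) dvd 1" unfolding xyz[symmetric] by (intro dvd_add dvd_mult)
    then obtain k where k: "1 = D $$ (0, 0) * k" by (elim dvdE)
    obtain P Q where P: "P \<in> carrier_mat 2 2" and Q: "Q \<in> carrier_mat 2 2" and D_eq: "D = P * A * Q"
      using AD A unfolding mat_equiv_def by auto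
    define p q v w where "p = P $$ (0, 0)" and "q = P $$ (0, 1)" and "v = Q $$ (0, 0)" and "w = Q $$ (1, 0)"
    have "D $$ (0, 0) = v * (p * a) + w * (p * b + q * c)"
      using P Q A A_simps unfolding D_eq p_def q_def v_def w_def
      by (simp add: scalar_prod_def numeral_2_eq_2 algebra_simps)
    then have "(k * v) * (p * a) + (k * w) * (p * b + q * c) = 1"
      using k by (simp add: algebra_simps)
    then have "(p * a, p * b + q * c) \<in> Um2" unfolding Um2_iff by blast
    then show "\<exists>p q. (p * a, p * b + q * c) \<in> Um2" by blast
  qed
qed

theorem mainTheorem12:
  assumes "bezout_domain TYPE('a::idom)"
  shows
    "(elementary_divisor_ring TYPE('a) \<longleftrightarrow>
       (\<forall>a b s :: 'a. \<exists>q r.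
          let y = r + s - a * s * q - b * s * r; t = 1 + q - a * q - b * r
          in t \<in> {u * y + v * (a * t) | u v. True}))
     \<and>
     (\<forall>a b s q r :: 'a.
        let y = r + s - a * s * q - b * s * r; t = 1 + q - a * q - b * r
        in t \<in> {u * y + v * (a * t) | u v. True} \<longleftrightarrow>
           (\<exists>y1 y2. y = y1 * y2 \<and> y1 dvd t \<and> (a, y2) \<in> Um2))
     \<and>
     (elementary_divisor_ring TYPE('a) \<longleftrightarrow>
       (\<forall>a b s :: 'a. \<exists>e f. (e, f) \<in> Um2 \<and> (a, e) \<in> Um2 \<and>
          (b * e + a * f, 1 - b * s - a) \<in> Um2))"
proof -
  note K = elementary_divisor_ring_iff_kaplansky_condition[OF assms] kaplansky_condition_iff_Um2[where 'a = 'a]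
  show ?thesis
    \<comment> \<open>Condition (2) turns into (3) triple by triple, so both equivalences become
      trivial and only the factorization claim is left.\<close>
    unfolding mem_condition_iff_Um2[OF assms] K
    unfolding Let_def mem_iff_factorization[OF assms] by blast
qed

end
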